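(* Let $T>0$ and let ${\bf v}:[-\log T,\infty)\times S^1\to\mathbb{R}^3$, ${\bf v}={\bf v}(\tau,x)$, be a smooth family of regular closed curves (${\bf v}'\neq 0$ everywhere) with ${\bf v}''\times{\bf v}'\neq 0$ everywhere, which solves $$ \partial_\tau{\bf v}=\frac12{\bf v}+\frac{{\bf v}'\times({\bf v}''\times{\bf v}')}{|{\bf v}'|^4}. $$ Then for every $\tau$, $$ \frac{d}{d\tau}\int_{S^1} e^{-\frac14|{\bf v}|^2}|{\bf v}'|\,dx= -\frac14\int_{S^1}|{\bf v}\cdot\gamma|^2 e^{-\frac14|{\bf v}|^2}|{\bf v}'|\,dx -\int_{S^1}|\partial_\tau{\bf v}\cdot\nu|^2 e^{-\frac14|{\bf v}|^2}|{\bf v}'|\,dx, $$ where $\nu$ is the unit normal vector and $\gamma$ is the unit binormal vector of the curve ${\bf v}(\tau,\cdot)$.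
   Context: A prime denotes the derivative with respect to $x\in S^1$ (with $S^1$ parametrized as a circle, i.e. functions of $x$ are periodic), $\times$ and $\cdot$ are the cross product and the dot product in $\mathbb{R}^3$, and $|\cdot|$ is the Euclidean norm. For a regular curve ${\bf v}(\tau,\cdot)$ with ${\bf v}''\times{\bf v}'\ne0$, the unit normal and unit binormal are $$ \nu=\frac{{\bf v}'\times({\bf v}''\times{\bf v}')}{|{\bf v}'|\,|{\bf v}''\times{\bf v}'|},\qquad \gamma=\frac{{\bf v}''\times{\bf v}'}{|{\bf v}''\times{\bf v}'|}. $$ The equation arises from the curve shortening flow $\partial_t{\bf u}=H\nu$ in $\mathbb{R}^3$ (with $H=|{\bf u}''\times{\bf u}'|/|{\bf u}'|^3$ the curvature), ${\bf u}:[0,T)\times S^1\to\mathbb{R}^3$, by the rescaling $\tau=-\log(T-t)$, ${\bf v}(\tau,x)=(T-t)^{-1/2}{\bf u}(t,x)$. At the initial time $\tau=-\log T$ derivatives in $\tau$ are one-sided. *)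

theory Defs
  imports "HOL-Analysis.Analysis"
begin

(* Derivatives are taken within S, so that they are one-sided at boundary points of S. They are
   uniquely determined when S is convex with nonempty interior, the case used here
   (a closed half-plane). *)
fun k_times_differentiable_on ::
  "nat \<Rightarrow> ('a::real_normed_vector \<Rightarrow> 'b::real_normed_vector) \<Rightarrow> 'a set \<Rightarrow> bool" where
  "k_times_differentiable_on 0 f S \<longleftrightarrow> continuous_on S f"
| "k_times_differentiable_on (Suc k) f S \<longleftrightarrow>
     f differentiable_on S \<and>
     (\<forall>w. k_times_differentiable_on k (\<lambda>p. frechet_derivative f (at p within S) w) S)"

definition smooth_on ::
  "('a::real_normed_vector \<Rightarrow> 'b::real_normed_vector) \<Rightarrow> 'a set \<Rightarrow> bool" where
  "smooth_on f S \<longleftrightarrow> (\<forall>k. k_times_differentiable_on k f S)"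

definition D1 :: "(real \<Rightarrow> real ^ 3) \<Rightarrow> real \<Rightarrow> real ^ 3" where
  "D1 c x = vector_derivative c (at x)"

definition D2 :: "(real \<Rightarrow> real ^ 3) \<Rightarrow> real \<Rightarrow> real ^ 3" where
  "D2 c = D1 (D1 c)"

definition unit_normal :: "(real \<Rightarrow> real ^ 3) \<Rightarrow> real \<Rightarrow> real ^ 3" where
  "unit_normal c x =
     (1 / (norm (D1 c x) * norm (cross3 (D2 c x) (D1 c x)))) *\<^sub>R
       cross3 (D1 c x) (cross3 (D2 c x) (D1 c x))"

definition unit_binormal :: "(real \<Rightarrow> real ^ 3) \<Rightarrow> real \<Rightarrow> real ^ 3" where
  "unit_binormal c x =
     (1 / norm (cross3 (D2 c x) (D1 c x))) *\<^sub>R cross3 (D2 c x) (D1 c x)"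

(* One-sided at the initial time t0. *)
definition time_deriv ::
  "real \<Rightarrow> (real \<Rightarrow> real \<Rightarrow> real ^ 3) \<Rightarrow> real \<Rightarrow> real \<Rightarrow> real ^ 3" where
  "time_deriv t0 v \<tau> x = vector_derivative (\<lambda>s. v s x) (at \<tau> within {t0..})"

(* The circle is R / (2 pi Z): functions on it are 2 pi-periodic functions on the real line,
   integrated over one period. *)
definition circle_integral :: "(real \<Rightarrow> real) \<Rightarrow> real" where
  "circle_integral f = integral {0..2 * pi} f"

definition gauss_length_density :: "(real \<Rightarrow> real ^ 3) \<Rightarrow> real \<Rightarrow> real" where
  "gauss_length_density c x = exp (- (1 / 4) * (norm (c x))\<^sup>2) * norm (D1 c x)"

end

theory Submission
  imports Defs
begin

text \<open>Write \<open>e = exp (- \<bar>v\<bar>\<^sup>2 / 4)\<close> and let \<open>t\<close>, \<open>\<nu>\<close>, \<open>\<gamma>\<close> be the unit tangent, normal and binormal and \<open>k\<close>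
  the curvature vector, so that \<open>\<partial>\<^sub>\<tau>v = v/2 + k\<close>.  The \<open>\<tau>\<close>-derivative of \<open>e \<bar>v'\<bar>\<close> is the exact derivative
  \<open>(e t \<bullet> \<partial>\<^sub>\<tau>v)'\<close>, which integrates to zero over the circle, minus \<open>e \<bar>v'\<bar>\<close> times
  \<open>(v/2 - (v \<bullet> t) t / 2 + k) \<bullet> \<partial>\<^sub>\<tau>v\<close>.  The first factor of that product is the projection of \<open>\<partial>\<^sub>\<tau>v\<close> to the normal
  plane, so the product is \<open>(\<partial>\<^sub>\<tau>v \<bullet> \<nu>)\<^sup>2 + (\<partial>\<^sub>\<tau>v \<bullet> \<gamma>)\<^sup>2\<close>, and \<open>\<partial>\<^sub>\<tau>v \<bullet> \<gamma> = (v \<bullet> \<gamma>) / 2\<close> because \<open>k\<close> is parallel to \<open>\<nu>\<close>.\<close>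

text \<open>Differentiating \<open>v s y - v s a = \<integral> A s\<close> under the integral, rather than using an interior-point
  symmetry theorem, makes this available at the initial time, on the boundary of the domain.\<close>
lemma mixed_partial_derivatives_commute:
  fixes v :: "real \<Rightarrow> real \<Rightarrow> 'a::euclidean_space"
  assumes U: "convex U" "\<tau> \<in> U" "at \<tau> within U \<noteq> bot"
    and vx: "\<And>s x. s \<in> U \<Longrightarrow> (v s has_vector_derivative A s x) (at x)"
    and vt: "\<And>s x. s \<in> U \<Longrightarrow> ((\<lambda>s. v s x) has_vector_derivative B s x) (at s within U)"
    and At: "\<And>s x. s \<in> U \<Longrightarrow> ((\<lambda>s. A s x) has_vector_derivative C s x) (at s within U)"
    and C: "continuous_on (U \<times> UNIV) (\<lambda>p. C (fst p) (snd p))"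
  shows "(B \<tau> has_vector_derivative C \<tau> x) (at x)"
proof -
  \<comment> \<open>The radius 1 is arbitrary: \<open>x\<close> only has to be interior, so that the
    derivative within \<open>{a..b}\<close> obtained below is a full one.\<close>
  define a b where "a = x - 1" and "b = x + 1"
  have C\<tau>: "continuous_on X (C \<tau>)" for X
    using continuous_on_compose2[OF C continuous_on_Pair[OF continuous_on_const continuous_on_id],
        of \<tau> X] U(2) by auto
  have eq: "B \<tau> y = B \<tau> a + integral {a..y} (C \<tau>)" if "y \<in> {a..b}" for y
  proof -
    have ftc: "(A s has_integral (v s y - v s a)) {a..y}" if "s \<in> U" for s
      using \<open>y \<in> {a..b}\<close> vx[OF that]
      by (intro fundamental_theorem_of_calculus)
         (auto intro: has_vector_derivative_at_within)
    have "((\<lambda>s. integral (cbox a y) (A s)) has_vector_derivative integral (cbox a y) (C \<tau>))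
      (at \<tau> within U)"
    proof (rule leibniz_rule_vector_derivative)
      show "continuous_on (U \<times> cbox a y) (\<lambda>(s, t). C s t)"
        using continuous_on_subset[OF C, of "U \<times> cbox a y"] by (auto simp: case_prod_beta)
    qed (use U At ftc in \<open>auto simp: integrable_on_def\<close>)
    then have "((\<lambda>s. v s y - v s a) has_vector_derivative integral {a..y} (C \<tau>)) (at \<tau> within U)"
      unfolding box_real
      by (rule has_vector_derivative_transform[rotated 2])
         (use U in \<open>auto simp: integral_unique[OF ftc]\<close>)
    moreover have "((\<lambda>s. v s y - v s a) has_vector_derivative (B \<tau> y - B \<tau> a)) (at \<tau> within U)"
      using vt U(2) by (intro derivative_intros) auto
    ultimately have "integral {a..y} (C \<tau>) = B \<tau> y - B \<tau> a"
      using vector_derivative_unique_within[OF U(3)] by blast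
    then show ?thesis by simp
  qed
  have "((\<lambda>y. B \<tau> a + integral {a..y} (C \<tau>)) has_vector_derivative 0 + C \<tau> x) (at x within {a..b})"
    by (intro derivative_intros integral_has_vector_derivative C\<tau>) (auto simp: a_def b_def)
  then have "(B \<tau> has_vector_derivative C \<tau> x) (at x within {a..b})"
    using has_vector_derivative_transform[of x "{a..b}" "B \<tau>", OF _ eq] by (simp add: a_def b_def)
  then show ?thesis
    by (simp add: at_within_Icc_at a_def b_def)
qed

section \<open>Smooth maps on a half-plane and their slices\<close>

lemma smooth_on_derivative:
  assumes "smooth_on f S"
  shows "smooth_on (\<lambda>p. frechet_derivative f (at p within S) w) S"
  using assms k_times_differentiable_on.simps(2) unfolding smooth_on_def by blast

lemma smooth_on_imp_continuous_on: "smooth_on f S \<Longrightarrow> continuous_on S f"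
  unfolding smooth_on_def using k_times_differentiable_on.simps(1) by blast

lemma smooth_on_has_derivative:
  assumes "smooth_on f S" "p \<in> S"
  shows "(f has_derivative frechet_derivative f (at p within S)) (at p within S)"
proof -
  have "k_times_differentiable_on (Suc 0) f S"
    using assms unfolding smooth_on_def by blast
  then show ?thesis
    using assms(2) by (auto simp: differentiable_on_def frechet_derivative_works)
qed

text \<open>The line of constant time \<open>s\<close> lies in the half-plane even for
  \<open>s = a\<close>, so restricting the derivative within the half-plane to it gives a two-sided
  derivative in \<open>x\<close>. The ray of constant \<open>x\<close>, used for time derivatives,
  is one-sided at \<open>a\<close>.\<close>

lemma smooth_on_space_derivative:
  assumes "smooth_on f ({a..} \<times> UNIV)" "a \<le> s"
  shows "((\<lambda>x. f (s, x)) has_vector_derivative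
    frechet_derivative f (at (s, x) within {a..} \<times> UNIV) (0, 1)) (at (x::real))"
proof -
  let ?D = "frechet_derivative f (at (s, x) within {a..} \<times> UNIV)"
  have D: "(f has_derivative ?D) (at (s, x) within {a..} \<times> UNIV)"
    using assms by (intro smooth_on_has_derivative) auto
  have "((\<lambda>x. (s, x)) has_vector_derivative (0, 1)) (at x)"
    by (auto intro!: derivative_eq_intros has_vector_derivative_Pair)
  moreover have "(f has_derivative ?D) (at (s, x) within range (Pair s))"
    using D by (rule has_derivative_subset) (use assms in auto)
  ultimately show ?thesis
    using vector_derivative_diff_chain_within[of "Pair s" "(0,1)" x UNIV f ?D]
    by (simp add: o_def)
qed

lemma smooth_on_time_derivative:
  assumes "smooth_on f ({a..} \<times> UNIV)" "a \<le> s"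
  shows "((\<lambda>s. f (s, x)) has_vector_derivative
    frechet_derivative f (at (s, x) within {a..} \<times> UNIV) (1, 0)) (at (s::real) within {a..})"
proof -
  let ?D = "frechet_derivative f (at (s, x) within {a..} \<times> UNIV)"
  have D: "(f has_derivative ?D) (at (s, x) within {a..} \<times> UNIV)"
    using assms by (intro smooth_on_has_derivative) auto
  have "((\<lambda>s. (s, x)) has_vector_derivative (1, 0)) (at s within {a..})"
    by (auto intro!: derivative_eq_intros has_vector_derivative_Pair)
  moreover have "(f has_derivative ?D) (at (s, x) within (\<lambda>s. (s, x)) ` {a..})"
    using D by (rule has_derivative_subset) (use assms in auto)
  ultimately show ?thesis
    using vector_derivative_diff_chain_within[of "\<lambda>s. (s, x)" "(1,0)" s "{a..}" f ?D]
    by (simp add: o_def)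
qed

section \<open>Derivatives of the length element and of the Gaussian weight\<close>

lemma has_real_derivative_inner:
  fixes f g :: "real \<Rightarrow> 'a::real_inner"
  assumes "(f has_vector_derivative f') (at x within S)" "(g has_vector_derivative g') (at x within S)"
  shows "((\<lambda>x. f x \<bullet> g x) has_real_derivative f x \<bullet> g' + f' \<bullet> g x) (at x within S)"
  using bounded_bilinear.has_vector_derivative[OF bounded_bilinear_inner assms]
  by (simp add: has_real_derivative_iff_has_vector_derivative)

lemma has_real_derivative_norm:
  fixes f :: "real \<Rightarrow> 'a::real_inner"
  assumes "(f has_vector_derivative f') (at x within S)" "f x \<noteq> 0"
  shows "((\<lambda>x. norm (f x)) has_real_derivative (f x \<bullet> f') / norm (f x)) (at x within S)"
proof -
  have "((\<lambda>x. sqrt (f x \<bullet> f x)) has_real_derivative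
      (f x \<bullet> f' + f' \<bullet> f x) * (inverse (sqrt (f x \<bullet> f x)) / 2)) (at x within S)"
    using assms(2) DERIV_chain2[OF DERIV_real_sqrt has_real_derivative_inner[OF assms(1) assms(1)]]
    by (simp add: mult.commute)
  then show ?thesis
    by (simp add: norm_eq_sqrt_inner inner_commute field_simps)
qed

lemma has_real_derivative_gaussian:
  fixes f :: "real \<Rightarrow> 'a::real_inner"
  assumes "(f has_vector_derivative f') (at x within S)"
  shows "((\<lambda>x. exp (- (1 / 4) * (norm (f x))\<^sup>2)) has_real_derivative
    - (1 / 2) * (f x \<bullet> f') * exp (- (1 / 4) * (norm (f x))\<^sup>2)) (at x within S)"
proof -
  have "((\<lambda>x. exp (- (1 / 4) * (f x \<bullet> f x))) has_real_derivative
      - (1 / 2) * (f x \<bullet> f') * exp (- (1 / 4) * (f x \<bullet> f x))) (at x within S)"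
    by (rule derivative_eq_intros has_real_derivative_inner[OF assms assms] refl)+
       (simp add: inner_commute)
  then show ?thesis by (simp add: power2_norm_eq_inner)
qed

section \<open>Algebra in the frame of tangent, normal and binormal\<close>

text \<open>Parseval's identity in the orthogonal frame \<open>a\<close>, \<open>w\<close>,
  \<open>cross3 a w\<close>, multiplied by the squared lengths so that no vector has to be
  nonzero.\<close>

lemma orthogonal_cross_frame_inner:
  fixes a w x y :: "real ^ 3"
  assumes "a \<bullet> w = 0"
  shows "(a \<bullet> a) * (w \<bullet> w) * (x \<bullet> y) =
    (w \<bullet> w) * (x \<bullet> a) * (y \<bullet> a) + (a \<bullet> a) * (x \<bullet> w) * (y \<bullet> w)
    + (x \<bullet> cross3 a w) * (y \<bullet> cross3 a w)"
proof -
  \<comment> \<open>\<open>det (x, a, w) det (y, a, w)\<close> is the Gram determinant of the two triples\<close>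
  have "(x \<bullet> cross3 a w) * (y \<bullet> cross3 a w) =
    (x \<bullet> y) * ((a \<bullet> a) * (w \<bullet> w) - (a \<bullet> w)\<^sup>2)
    - (x \<bullet> a) * ((y \<bullet> a) * (w \<bullet> w) - (a \<bullet> w) * (y \<bullet> w))
    + (x \<bullet> w) * ((y \<bullet> a) * (a \<bullet> w) - (a \<bullet> a) * (y \<bullet> w))"
    by (simp add: cross3_def inner_vec_def sum_3 power2_eq_square) algebra
  then show ?thesis using assms by (simp add: algebra_simps)
qed

text \<open>Here \<open>a\<close>, \<open>a2\<close>, \<open>b\<close>, \<open>c\<close> stand for \<open>v'\<close>, \<open>v''\<close>, \<open>\<partial>\<^sub>\<tau>v\<close>, \<open>\<partial>\<^sub>\<tau>v'\<close>.  Multiplied by the Gaussian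
  weight, the left-hand side is the \<open>\<tau>\<close>-derivative of the density, and the last three summands on
  the right form the \<open>x\<close>-derivative of the weight times \<open>(v' \<bullet> \<partial>\<^sub>\<tau>v) / \<bar>v'\<bar>\<close>.\<close>
lemma density_derivative_identity:
  fixes a a2 b c v :: "real ^ 3"
  defines "w \<equiv> cross3 a2 a"
  assumes a: "a \<noteq> 0" and w: "w \<noteq> 0"
    and b: "b = (1 / 2) *\<^sub>R v + (1 / norm a ^ 4) *\<^sub>R cross3 a w"
  shows "- (1 / 2) * (v \<bullet> b) * norm a + (a \<bullet> c) / norm a =
    - (1 / 4) * ((v \<bullet> ((1 / norm w) *\<^sub>R w))\<^sup>2 * norm a)
    - (b \<bullet> ((1 / (norm a * norm w)) *\<^sub>R cross3 a w))\<^sup>2 * norm a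
    + (- (1 / 2) * (v \<bullet> a) * ((a \<bullet> b) / norm a)
       + (a \<bullet> c + a2 \<bullet> b) / norm a - (a \<bullet> b) * (a \<bullet> a2) / norm a ^ 3)"
proof -
  define n m where "n = norm a" and "m = norm w"
  have n: "n > 0" "a \<bullet> a = n\<^sup>2" and m: "m > 0" "w \<bullet> w = m\<^sup>2"
    using a w by (auto simp: n_def m_def power2_norm_eq_inner)
  \<comment> \<open>\<open>p\<close>, \<open>q\<close>, \<open>r\<close> are the components of
    \<open>v\<close> along the unit tangent, binormal and normal, and \<open>k\<close> is the
    curvature.\<close>
  define p q r k where "p = (v \<bullet> a) / n" and "q = (v \<bullet> w) / m"
    and "r = (v \<bullet> cross3 a w) / (n * m)" and "k = m / n ^ 3"
  have pqr: "v \<bullet> a = n * p" "v \<bullet> w = m * q" "v \<bullet> cross3 a w = n * m * r" "m = n ^ 3 * k"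
    using n m by (simp_all add: p_def q_def r_def k_def)
  have aw: "a \<bullet> w = 0" by (simp add: w_def dot_cross_self)
  have N: "cross3 a w = n\<^sup>2 *\<^sub>R a2 - (a \<bullet> a2) *\<^sub>R a"
    using n(2) by (simp add: w_def Lagrange)
  have NN: "cross3 a w \<bullet> cross3 a w = n\<^sup>2 * m\<^sup>2"
    using n m aw by (simp add: dot_cross)
  have "(n\<^sup>2 * m\<^sup>2) * (v \<bullet> v) = (n\<^sup>2 * m\<^sup>2) * (p\<^sup>2 + q\<^sup>2 + r\<^sup>2)"
    using orthogonal_cross_frame_inner[OF aw, of v v]
    unfolding pqr(1-3) n(2) m(2) by (simp add: power2_eq_square algebra_simps)
  then have vv: "v \<bullet> v = p\<^sup>2 + q\<^sup>2 + r\<^sup>2"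
    using n m by simp
  have "b \<bullet> cross3 a w = (n * m * r) / 2 + (n\<^sup>2 * m\<^sup>2) / n ^ 4"
    by (simp add: b inner_add_left NN pqr(3) flip: n_def)
  also have "\<dots> = n * m * (r / 2 + k)"
    using n m by (simp add: k_def field_simps power_numeral_reduce)
  finally have bN: "b \<bullet> cross3 a w = n * m * (r / 2 + k)" .
  have ab: "a \<bullet> b = n * p / 2"
    using pqr(1) by (simp add: b inner_add_right dot_cross_self inner_commute)
  have "v \<bullet> b = (v \<bullet> v) / 2 + n * m * r / n ^ 4"
    by (simp add: b inner_add_right pqr(3) flip: n_def)
  also have "n * m * r / n ^ 4 = k * r"
    using n by (simp add: k_def field_simps power_numeral_reduce)
  finally have vb: "v \<bullet> b = (p\<^sup>2 + q\<^sup>2 + r\<^sup>2) / 2 + k * r" by (simp add: vv)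
  \<comment> \<open>\<open>N\<close> splits \<open>n\<^sup>2 *\<^sub>R a2\<close> into a normal and
    a tangential part, so pairing it with \<open>b\<close> yields \<open>a2 \<bullet> b\<close> from
    \<open>bN\<close> and \<open>ab\<close>.\<close>
  have "n\<^sup>2 * (a2 \<bullet> b) = b \<bullet> cross3 a w + (a \<bullet> a2) * (a \<bullet> b)"
    unfolding N by (simp add: inner_diff_right inner_commute)
  also have "\<dots> = n\<^sup>2 * (n\<^sup>2 * k * (r / 2 + k) + (a \<bullet> a2) * p / (2 * n))"
    unfolding bN ab using n by (simp add: pqr(4) field_simps power_numeral_reduce)
  finally have a2b: "a2 \<bullet> b = n\<^sup>2 * k * (r / 2 + k) + (a \<bullet> a2) * p / (2 * n)"
    using n by simp
  have gam: "v \<bullet> ((1 / m) *\<^sub>R w) = q" and nu: "b \<bullet> ((1 / (n * m)) *\<^sub>R cross3 a w) = r / 2 + k"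
    using n m by (simp_all add: q_def bN)
  \<comment> \<open>The first right-hand side has the shape of the tangential part of
    \<open>a2 \<bullet> b\<close> divided by \<open>n\<close>, so the two cancel; the terms with
    \<open>c\<close> cancel too, leaving a polynomial identity in \<open>n\<close>,
    \<open>p\<close>, \<open>q\<close>, \<open>r\<close>, \<open>k\<close>.\<close>
  have tang: "(a \<bullet> b) * (a \<bullet> a2) / n ^ 3 = (a \<bullet> a2) * p / (2 * n) / n"
    "- (1 / 2) * (v \<bullet> a) * ((a \<bullet> b) / n) = - (1 / 4) * p\<^sup>2 * n"
    "(n\<^sup>2 * k * (r / 2 + k)) / n = n * k * (r / 2 + k)"
    using n by (simp_all add: ab pqr(1) field_simps power_numeral_reduce)
  show ?thesis
    unfolding n_def[symmetric] m_def[symmetric] gam nu tang a2b vb add_divide_distrib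
    by (simp add: algebra_simps power2_eq_square)
qed

theorem mainTheorem1:
  fixes T :: real and v :: "real \<Rightarrow> real \<Rightarrow> real ^ 3"
  assumes "T > 0"
    and periodic: "\<And>\<tau> x. \<tau> \<ge> - ln T \<Longrightarrow> v \<tau> (x + 2 * pi) = v \<tau> x"
    and smooth: "smooth_on (\<lambda>p. v (fst p) (snd p)) ({- ln T..} \<times> UNIV)"
    and regular: "\<And>\<tau> x. \<tau> \<ge> - ln T \<Longrightarrow> D1 (v \<tau>) x \<noteq> 0"
    and curved: "\<And>\<tau> x. \<tau> \<ge> - ln T \<Longrightarrow> cross3 (D2 (v \<tau>) x) (D1 (v \<tau>) x) \<noteq> 0"
    and flow: "\<And>\<tau> x. \<tau> \<ge> - ln T \<Longrightarrow>
      time_deriv (- ln T) v \<tau> x =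
        (1 / 2) *\<^sub>R v \<tau> x
        + (1 / norm (D1 (v \<tau>) x) ^ 4) *\<^sub>R
            cross3 (D1 (v \<tau>) x) (cross3 (D2 (v \<tau>) x) (D1 (v \<tau>) x))"
  shows "\<forall>\<tau> \<ge> - ln T.
    ((\<lambda>s. circle_integral (\<lambda>x. gauss_length_density (v s) x)) has_real_derivative
      - (1 / 4) * circle_integral
          (\<lambda>x. \<bar>v \<tau> x \<bullet> unit_binormal (v \<tau>) x\<bar>\<^sup>2 * gauss_length_density (v \<tau>) x)
      - circle_integral
          (\<lambda>x. \<bar>time_deriv (- ln T) v \<tau> x \<bullet> unit_normal (v \<tau>) x\<bar>\<^sup>2
                * gauss_length_density (v \<tau>) x))
      (at \<tau> within {- ln T..})"
proof (intro allI impI)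
  fix \<tau> :: real
  assume \<tau>: "\<tau> \<ge> - ln T"

  \<comment> \<open>Partial derivatives of the flow\<close>
  define t0 where "t0 = - ln T"
  define S where "S = {t0..} \<times> (UNIV :: real set)"
  define D where "D f w p = frechet_derivative f (at p within S) w"
    for f :: "real \<times> real \<Rightarrow> real ^ 3" and w p
  define F where "F p = v (fst p) (snd p)" for p
  \<comment> \<open>These are v', v'', the time derivative of v, and the time derivative of v'.
    \<open>Bx\<close> later identifies \<open>C\<close> with the \<open>x\<close>-derivative of
    \<open>B\<close> as well.\<close>
  define A where "A = D F (0, 1)"
  define A2 where "A2 = D A (0, 1)"
  define B where "B = D F (1, 0)"
  define C where "C = D A (1, 0)"
  have sm_D: "smooth_on (D f w) S" if "smooth_on f S" for f w
    using smooth_on_derivative[OF that, of w] by (simp add: D_def[abs_def])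
  have smF: "smooth_on F S"
    using smooth by (simp add: F_def[abs_def] S_def t0_def)
  note sm = smF sm_D[OF smF] sm_D[OF sm_D[OF smF]]
  have smA: "smooth_on A S" and smB: "smooth_on B S" and smA2: "smooth_on A2 S" and smC: "smooth_on C S"
    using sm by (simp_all add: A_def B_def A2_def C_def)
  have space: "((\<lambda>x. f (s, x)) has_vector_derivative D f (0, 1) (s, x)) (at x)"
    if "smooth_on f S" "s \<ge> t0" for f s x
    using smooth_on_space_derivative[of f t0 s] that by (simp add: D_def S_def)
  have time: "((\<lambda>s. f (s, x)) has_vector_derivative D f (1, 0) (s, x)) (at s within {t0..})"
    if "smooth_on f S" "s \<ge> t0" for f s x
    using smooth_on_time_derivative[of f t0 s] that by (simp add: D_def S_def)
  have vx: "(v s has_vector_derivative A (s, x)) (at x)" if "s \<ge> t0" for s x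
    using space[OF smF that] by (simp add: A_def F_def[abs_def])
  have vt: "((\<lambda>s. v s x) has_vector_derivative B (s, x)) (at s within {t0..})" if "s \<ge> t0" for s x
    using time[OF smF that] by (simp add: B_def F_def[abs_def])
  have Ax: "((\<lambda>x. A (s, x)) has_vector_derivative A2 (s, x)) (at x)" if "s \<ge> t0" for s x
    using space[OF smA that] by (simp add: A2_def)
  have At: "((\<lambda>s. A (s, x)) has_vector_derivative C (s, x)) (at s within {t0..})" if "s \<ge> t0" for s x
    using time[OF smA that] by (simp add: C_def)
  have not_bot: "at s within {t0..} \<noteq> bot" if "s \<ge> t0" for s
  proof -
    have "at s within {s..s + 1} \<noteq> bot"
      by (simp add: trivial_limit_within islimpt_Icc)
    moreover have "at s within {s..s + 1} \<le> at s within {t0..}"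
      using that by (intro at_le) auto
    ultimately show ?thesis using bot.extremum_uniqueI by metis
  qed
  have D1: "D1 (v s) = (\<lambda>x. A (s, x))" if "s \<ge> t0" for s
    using vx[OF that] by (auto simp: D1_def fun_eq_iff intro: vector_derivative_at)
  have D2: "D2 (v s) = (\<lambda>x. A2 (s, x))" if "s \<ge> t0" for s
    using Ax[OF that] by (auto simp: D2_def D1[OF that] D1_def fun_eq_iff intro: vector_derivative_at)
  have B: "time_deriv t0 v s x = B (s, x)" if "s \<ge> t0" for s x
    unfolding time_deriv_def by (rule vector_derivative_within[OF not_bot[OF that] vt[OF that]])
  have Bx: "((\<lambda>x. B (s, x)) has_vector_derivative C (s, x)) (at x)" if "s \<ge> t0" for s x
    by (rule mixed_partial_derivatives_commute[where U = "{t0..}" and v = v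
          and A = "\<lambda>s x. A (s, x)" and B = "\<lambda>s x. B (s, x)" and C = "\<lambda>s x. C (s, x)"])
       (use that not_bot vx vt At smooth_on_imp_continuous_on[OF smC] in \<open>auto simp: S_def\<close>)
  have A0: "A (s, x) \<noteq> 0" if "s \<ge> t0" for s x
    using regular[of s x] that by (simp add: D1 t0_def[symmetric])
  have w0: "cross3 (A2 (s, x)) (A (s, x)) \<noteq> 0" if "s \<ge> t0" for s x
    using curved[of s x] that by (simp add: D1 D2 t0_def[symmetric])
  have Beq: "B (s, x) = (1 / 2) *\<^sub>R v s x + (1 / norm (A (s, x)) ^ 4) *\<^sub>R
      cross3 (A (s, x)) (cross3 (A2 (s, x)) (A (s, x)))" if "s \<ge> t0" for s x
    using flow[of s x] that by (simp add: B D1 D2 t0_def[symmetric])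

  \<comment> \<open>Differentiating the weighted length under the integral\<close>
  define e where "e s x = exp (- (1 / 4) * (norm (v s x))\<^sup>2)" for s x
  define g where "g s x = e s x * (- (1 / 2) * (v s x \<bullet> B (s, x)) * norm (A (s, x))
      + (A (s, x) \<bullet> C (s, x)) / norm (A (s, x)))" for s x
  have dens: "gauss_length_density (v s) x = e s x * norm (A (s, x))" if "s \<ge> t0" for s x
    by (simp add: gauss_length_density_def e_def D1 that)
  have dens_t: "((\<lambda>s. gauss_length_density (v s) x) has_real_derivative g s x) (at s within {t0..})"
    if "s \<ge> t0" for s x
  proof -
    have "((\<lambda>s. e s x * norm (A (s, x))) has_real_derivative g s x) (at s within {t0..})"
      unfolding e_def
      by (rule derivative_eq_intros has_real_derivative_gaussian[OF vt[OF that]]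
          has_real_derivative_norm[OF At[OF that]] A0[OF that] refl)+
         (simp add: g_def e_def algebra_simps)
    then show ?thesis
      unfolding has_real_derivative_iff_has_vector_derivative
      by (rule has_vector_derivative_transform[rotated 2]) (use that dens in auto)
  qed
  have cF: "continuous_on S (\<lambda>p. v (fst p) (snd p))"
    using smooth_on_imp_continuous_on[OF smF] by (simp add: F_def[abs_def])
  note cont = smooth_on_imp_continuous_on[OF smA] smooth_on_imp_continuous_on[OF smA2]
    smooth_on_imp_continuous_on[OF smB] smooth_on_imp_continuous_on[OF smC]
  have A0': "A p \<noteq> 0" and w0': "cross3 (A2 p) (A p) \<noteq> 0" if "p \<in> S" for p
    using A0[of "fst p" "snd p"] w0[of "fst p" "snd p"] that by (auto simp: S_def)
  have slice: "continuous_on X (\<lambda>x. f (s, x))" if "continuous_on S f" "s \<ge> t0"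
    for f :: "real \<times> real \<Rightarrow> real" and s X
    by (rule continuous_on_compose2[OF that(1)]) (use that(2) in \<open>auto simp: S_def intro!: continuous_intros\<close>)
  have dens_cont: "continuous_on S (\<lambda>p. e (fst p) (snd p) * norm (A p))"
    unfolding e_def by (intro continuous_intros cF cont)
  have g_cont: "continuous_on S (\<lambda>p. g (fst p) (snd p))"
    using A0' unfolding g_def e_def prod.collapse by (intro continuous_intros cF cont) auto
  have "((\<lambda>s. integral (cbox 0 (2 * pi)) (gauss_length_density (v s))) has_field_derivative
      integral (cbox 0 (2 * pi)) (g \<tau>)) (at \<tau> within {t0..})"
  proof (rule leibniz_rule_field_derivative)
    show "gauss_length_density (v s) integrable_on cbox 0 (2 * pi)" if "s \<in> {t0..}" for s
    proof -
      have "gauss_length_density (v s) = (\<lambda>x. e s x * norm (A (s, x)))"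
        using that dens by auto
      then show ?thesis
        using slice[OF dens_cont, of s] that by (auto intro!: integrable_continuous_real)
    qed
    show "continuous_on ({t0..} \<times> cbox 0 (2 * pi)) (\<lambda>(s, x). g s x)"
      using continuous_on_subset[OF g_cont, of "{t0..} \<times> cbox 0 (2 * pi)"]
      by (auto simp: S_def case_prod_beta)
  qed (use \<tau> dens_t in \<open>auto simp: t0_def\<close>)
  then have deriv: "((\<lambda>s. circle_integral (\<lambda>x. gauss_length_density (v s) x)) has_real_derivative
      integral {0..2 * pi} (g \<tau>)) (at \<tau> within {t0..})"
    by (simp add: circle_integral_def)

  \<comment> \<open>Splitting off the exact derivative and integrating over the circle\<close>
  define P where "P x = (v \<tau> x \<bullet> unit_binormal (v \<tau>) x)\<^sup>2 * gauss_length_density (v \<tau>) x" for x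
  define Q where "Q x = (time_deriv t0 v \<tau> x \<bullet> unit_normal (v \<tau>) x)\<^sup>2 * gauss_length_density (v \<tau>) x"
    for x
  \<comment> \<open>\<open>G\<close> is the weight times the tangential component of the velocity,
    and \<open>h\<close> its derivative, written in the shape of the last three summands of
    \<open>density_derivative_identity\<close>.\<close>
  define G where "G x = e \<tau> x * ((A (\<tau>, x) \<bullet> B (\<tau>, x)) / norm (A (\<tau>, x)))" for x
  define h where "h x = e \<tau> x * (- (1 / 2) * (v \<tau> x \<bullet> A (\<tau>, x)) * ((A (\<tau>, x) \<bullet> B (\<tau>, x)) / norm (A (\<tau>, x)))
       + (A (\<tau>, x) \<bullet> C (\<tau>, x) + A2 (\<tau>, x) \<bullet> B (\<tau>, x)) / norm (A (\<tau>, x))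
       - (A (\<tau>, x) \<bullet> B (\<tau>, x)) * (A (\<tau>, x) \<bullet> A2 (\<tau>, x)) / norm (A (\<tau>, x)) ^ 3)" for x
  have \<tau>0: "\<tau> \<ge> t0" using \<tau> by (simp add: t0_def)
  have g_eq: "g \<tau> x = - (1 / 4) * P x - Q x + h x" for x
    unfolding g_def density_derivative_identity[OF A0[OF \<tau>0] w0[OF \<tau>0] Beq[OF \<tau>0]]
    by (simp add: P_def Q_def h_def unit_binormal_def unit_normal_def D1 D2 B dens \<tau>0 algebra_simps)
  have G_deriv: "(G has_real_derivative h x) (at x)" for x
  proof -
    have quot: "(c * n - d * (f / n)) / (n * n) = c / n - d * f / n ^ 3" if "n \<noteq> 0" for c d f n :: real
      using that by (simp add: field_simps power3_eq_cube)
    note num = has_real_derivative_inner[OF Ax[OF \<tau>0] Bx[OF \<tau>0]]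
    note den = has_real_derivative_norm[OF Ax[OF \<tau>0] A0[OF \<tau>0]]
    note gauss = has_real_derivative_gaussian[OF vx[OF \<tau>0], folded e_def]
    have n0: "norm (A (\<tau>, x)) \<noteq> 0" using A0[OF \<tau>0] by simp
    from DERIV_mult[OF gauss DERIV_divide[OF num den n0]] show ?thesis
      unfolding G_def[abs_def] quot[OF n0] h_def
      by (rule DERIV_cong) (simp add: algebra_simps)
  qed
  \<comment> \<open>The boundary values of \<open>G\<close> agree once periodicity passes to both
    first derivatives: shift \<open>v \<tau>\<close> by a period for \<open>A\<close>, and
    differentiate \<open>per\<close> in time for \<open>B\<close>.\<close>
  have per: "v s (2 * pi) = v s 0" if "s \<ge> t0" for s
    using periodic[of s 0] that by (simp add: t0_def)
  have "((\<lambda>x. x + 2 * pi) has_vector_derivative 1) (at 0)"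
    by (auto intro!: derivative_eq_intros simp flip: has_real_derivative_iff_has_vector_derivative)
  then have "((\<lambda>x. v \<tau> (x + 2 * pi)) has_vector_derivative A (\<tau>, 2 * pi)) (at 0)"
    using vector_diff_chain_at[of "\<lambda>x. x + 2 * pi" 1 0 "v \<tau>"] vx[OF \<tau>0, of "2 * pi"]
    by (simp add: o_def)
  then have perA: "A (\<tau>, 2 * pi) = A (\<tau>, 0)"
    using vx[OF \<tau>0, of 0] periodic[OF \<tau>] by (simp add: vector_derivative_unique_at)
  have "((\<lambda>s. v s 0) has_vector_derivative B (\<tau>, 2 * pi)) (at \<tau> within {t0..})"
    by (rule has_vector_derivative_transform[OF _ _ vt[OF \<tau>0]]) (use \<tau>0 per in auto)
  then have perB: "B (\<tau>, 2 * pi) = B (\<tau>, 0)"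
    using vt[OF \<tau>0, of 0] vector_derivative_unique_within[OF not_bot[OF \<tau>0]] by blast
  have "(h has_integral G (2 * pi) - G 0) {0..2 * pi}"
    using G_deriv
    by (intro fundamental_theorem_of_calculus)
       (auto simp: has_real_derivative_iff_has_vector_derivative intro: has_vector_derivative_at_within)
  moreover have "G (2 * pi) = G 0"
    by (simp add: G_def e_def per[OF \<tau>0] perA perB)
  ultimately have h_int: "(h has_integral 0) {0..2 * pi}" by simp
  \<comment> \<open>Continuity of \<open>P\<close> and then \<open>Q\<close>, whose denominators
    vanish nowhere on \<open>S\<close>, gives the integrability needed to split the integral of
    \<open>g \<tau>\<close>.\<close>
  have "continuous_on S (\<lambda>p. (v (fst p) (snd p) \<bullet>
      ((1 / norm (cross3 (A2 p) (A p))) *\<^sub>R cross3 (A2 p) (A p)))\<^sup>2 * (e (fst p) (snd p) * norm (A p)))"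
    using w0' by (intro continuous_intros continuous_on_cross cF cont dens_cont) auto
  from slice[OF this \<tau>0] have "continuous_on {0..2 * pi} P"
    by (simp add: P_def[abs_def] unit_binormal_def D1 D2 dens \<tau>0)
  then have P_int: "P integrable_on {0..2 * pi}" by (rule integrable_continuous_real)
  have "continuous_on S (\<lambda>p. (B p \<bullet>
      ((1 / (norm (A p) * norm (cross3 (A2 p) (A p)))) *\<^sub>R cross3 (A p) (cross3 (A2 p) (A p))))\<^sup>2
        * (e (fst p) (snd p) * norm (A p)))"
    using w0' A0' by (intro continuous_intros continuous_on_cross cF cont dens_cont) auto
  from slice[OF this \<tau>0] have "continuous_on {0..2 * pi} Q"
    by (simp add: Q_def[abs_def] unit_normal_def D1 D2 dens B \<tau>0)
  then have Q_int: "Q integrable_on {0..2 * pi}" by (rule integrable_continuous_real)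
  have "((\<lambda>x. - (1 / 4) * P x - Q x + h x) has_integral
      - (1 / 4) * circle_integral P - circle_integral Q + 0) {0..2 * pi}"
    unfolding circle_integral_def
    by (intro has_integral_add has_integral_diff has_integral_mult_right h_int
        integrable_integral P_int Q_int)
  then have "integral {0..2 * pi} (g \<tau>) = - (1 / 4) * circle_integral P - circle_integral Q"
    unfolding g_eq[symmetric] by (simp add: integral_unique)
  with deriv show "((\<lambda>s. circle_integral (\<lambda>x. gauss_length_density (v s) x)) has_real_derivative
      - (1 / 4) * circle_integral
          (\<lambda>x. \<bar>v \<tau> x \<bullet> unit_binormal (v \<tau>) x\<bar>\<^sup>2 * gauss_length_density (v \<tau>) x)
      - circle_integral
          (\<lambda>x. \<bar>time_deriv (- ln T) v \<tau> x \<bullet> unit_normal (v \<tau>) x\<bar>\<^sup>2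
                * gauss_length_density (v \<tau>) x))
      (at \<tau> within {- ln T..})"
    unfolding power2_abs by (simp add: P_def[abs_def] Q_def[abs_def] t0_def)
qed

end
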